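(* Consider the optimization problem (P). Let $\alpha=\{i\in N\mid b_i>\bar\rho\}$, $\beta=\{i\in N\mid a_im_i+b_i<\underline{\rho}\}$ and $\theta=\{i\in N\mid \underline{\rho}-a_im_i\le b_i\le\bar\rho\}$. Then, denoting by $x^*,y^*$ the optimal $x,y$ of (P), $$x_i^*\in[\underline{\rho},\bar\rho],\quad y_i^*=0\quad\text{for all } i\in\alpha,\qquad\qquad x_i^*=\underline{\rho},\quad y_i^*=m_i\quad\text{for all } i\in\beta,$$ and $x_i^*,y_i^*$ for all $i\in\theta$ are the minimizers of the following convex problem: $$\begin{aligned}\min_{x_i,y_i,\ i\in\theta}\quad &\sum_{i\in\theta}x_iy_i+\sum_{i\in\beta}\underline{\rho}\,m_i+p\Big(f-\sum_{i\in\theta}y_i-\sum_{i\in\beta}m_i\Big)\\ \text{subject to}\quad &\underline{\rho}\le x_i\le\bar\rho\quad\text{for all } i\in\theta,\\ &\sum_{i\in\theta}y_i\le f-\sum_{i\in\beta}m_i,\\ &y_i=\frac{x_i-b_i}{a_i},\quad b_i\le x_i\le a_im_i+b_i\quad\text{for all } i\in\theta.\end{aligned}$$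
   Context: Let $N=\{1,\dots,n\}$. The given data are real numbers $a_i>0$, $m_i>0$, $b_i\in\mathbb{R}$ ($i\in N$), $p>0$, $f>0$ and nonnegative lower and upper price bounds $\underline{\rho}\le\bar\rho$. Problem (P), in the variables $x,y,\mu,\nu\in\mathbb{R}^n$, is $$\min_{x,y,\mu,\nu}\ \phi(x,y)=\sum_{i\in N}x_iy_i+p\Big(f-\sum_{i\in N}y_i\Big)$$ subject to $\underline{\rho}\le x_i\le\bar\rho$ for all $i\in N$, $\sum_{i\in N}y_i\le f$, and, for all $i\in N$, $$(y_i,\mu_i,\nu_i)=\begin{cases}(0,\ b_i-x_i,\ 0)& \text{if } x_i<b_i,\\ \big(\tfrac{x_i-b_i}{a_i},\ 0,\ 0\big)&\text{if } b_i\le x_i\le a_im_i+b_i,\\ (m_i,\ 0,\ x_i-a_im_i-b_i)&\text{if } x_i>a_im_i+b_i.\end{cases}$$ A superscript $*$ denotes optimal values of the variables of (P). The convexity of the problem in the claim is understood after substituting $y_i=(x_i-b_i)/a_i$.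
   Formalization: An optimal x* of (P) may have x_i* < b_i for some i in θ and is then infeasible for the convex problem; so the θ-claim is proved when b_i ≤ x_i* on θ, and for every optimum with x_i* replaced by max(x_i*, b_i); the converse is also proved. *)

theory Defs
  imports "HOL-Analysis.Analysis"
begin

text \<open>
  Problem (P) is \<open>P_objective\<close> minimised over \<open>P_feasible\<close>. The index set \<open>N = {1, ..., n}\<close> is the
  finite type \<open>'n\<close>, and \<open>lo\<close>, \<open>hi\<close> are the lower and upper price bounds.
\<close>

definition lower_level ::
  "real ^ 'n \<Rightarrow> real ^ 'n \<Rightarrow> real ^ 'n \<Rightarrow> real ^ 'n \<Rightarrow> real ^ 'n \<Rightarrow> real ^ 'n \<Rightarrow> real ^ 'n \<Rightarrow> 'n \<Rightarrow> bool"
  where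
  "lower_level a m b x y \<mu> \<nu> i \<longleftrightarrow>
     (y $ i, \<mu> $ i, \<nu> $ i) =
       (if x $ i < b $ i then (0, b $ i - x $ i, 0)
        else if x $ i \<le> a $ i * m $ i + b $ i then ((x $ i - b $ i) / a $ i, 0, 0)
        else (m $ i, 0, x $ i - a $ i * m $ i - b $ i))"

definition P_objective :: "real \<Rightarrow> real \<Rightarrow> real ^ 'n::finite \<Rightarrow> real ^ 'n \<Rightarrow> real" where
  "P_objective p f x y = (\<Sum>i\<in>UNIV. x $ i * y $ i) + p * (f - (\<Sum>i\<in>UNIV. y $ i))"

definition P_feasible ::
  "real ^ 'n::finite \<Rightarrow> real ^ 'n \<Rightarrow> real ^ 'n \<Rightarrow> real \<Rightarrow> real \<Rightarrow> real \<Rightarrow>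
   real ^ 'n \<Rightarrow> real ^ 'n \<Rightarrow> real ^ 'n \<Rightarrow> real ^ 'n \<Rightarrow> bool" where
  "P_feasible a m b f lo hi x y \<mu> \<nu> \<longleftrightarrow>
     (\<forall>i. lo \<le> x $ i \<and> x $ i \<le> hi) \<and>
     (\<Sum>i\<in>UNIV. y $ i) \<le> f \<and>
     (\<forall>i. lower_level a m b x y \<mu> \<nu> i)"

definition P_optimal ::
  "real ^ 'n::finite \<Rightarrow> real ^ 'n \<Rightarrow> real ^ 'n \<Rightarrow> real \<Rightarrow> real \<Rightarrow> real \<Rightarrow> real \<Rightarrow>
   real ^ 'n \<Rightarrow> real ^ 'n \<Rightarrow> real ^ 'n \<Rightarrow> real ^ 'n \<Rightarrow> bool" where
  "P_optimal a m b p f lo hi x y \<mu> \<nu> \<longleftrightarrow>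
     is_arg_min (\<lambda>(x, y, \<mu>, \<nu>). P_objective p f x y)
                (\<lambda>(x, y, \<mu>, \<nu>). P_feasible a m b f lo hi x y \<mu> \<nu>) (x, y, \<mu>, \<nu>)"

definition alpha_set :: "real ^ 'n \<Rightarrow> real \<Rightarrow> 'n set" where
  "alpha_set b hi = {i. b $ i > hi}"

definition beta_set :: "real ^ 'n \<Rightarrow> real ^ 'n \<Rightarrow> real ^ 'n \<Rightarrow> real \<Rightarrow> 'n set" where
  "beta_set a m b lo = {i. a $ i * m $ i + b $ i < lo}"

definition theta_set :: "real ^ 'n \<Rightarrow> real ^ 'n \<Rightarrow> real ^ 'n \<Rightarrow> real \<Rightarrow> real \<Rightarrow> 'n set" where
  "theta_set a m b lo hi = {i. lo - a $ i * m $ i \<le> b $ i \<and> b $ i \<le> hi}"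

text \<open>
  The reduced problem has variables \<open>x\<^sub>i\<close>, \<open>y\<^sub>i\<close> for \<open>i \<in> theta_set\<close> only. Its data are evaluated on
  full vectors, but only the components in \<open>theta_set\<close> are read; the others are irrelevant.
\<close>

definition R_objective ::
  "real ^ 'n::finite \<Rightarrow> real ^ 'n \<Rightarrow> real ^ 'n \<Rightarrow> real \<Rightarrow> real \<Rightarrow> real \<Rightarrow> real \<Rightarrow>
   real ^ 'n \<Rightarrow> real ^ 'n \<Rightarrow> real" where
  "R_objective a m b p f lo hi x y =
     (\<Sum>i\<in>theta_set a m b lo hi. x $ i * y $ i) +
     (\<Sum>i\<in>beta_set a m b lo. lo * m $ i) +
     p * (f - (\<Sum>i\<in>theta_set a m b lo hi. y $ i) - (\<Sum>i\<in>beta_set a m b lo. m $ i))"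

definition R_feasible ::
  "real ^ 'n::finite \<Rightarrow> real ^ 'n \<Rightarrow> real ^ 'n \<Rightarrow> real \<Rightarrow> real \<Rightarrow> real \<Rightarrow>
   real ^ 'n \<Rightarrow> real ^ 'n \<Rightarrow> bool" where
  "R_feasible a m b f lo hi x y \<longleftrightarrow>
     (\<forall>i\<in>theta_set a m b lo hi. lo \<le> x $ i \<and> x $ i \<le> hi) \<and>
     (\<Sum>i\<in>theta_set a m b lo hi. y $ i) \<le> f - (\<Sum>i\<in>beta_set a m b lo. m $ i) \<and>
     (\<forall>i\<in>theta_set a m b lo hi.
        y $ i = (x $ i - b $ i) / a $ i \<and> b $ i \<le> x $ i \<and> x $ i \<le> a $ i * m $ i + b $ i)"

definition R_minimizer ::
  "real ^ 'n::finite \<Rightarrow> real ^ 'n \<Rightarrow> real ^ 'n \<Rightarrow> real \<Rightarrow> real \<Rightarrow> real \<Rightarrow> real \<Rightarrow>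
   real ^ 'n \<Rightarrow> real ^ 'n \<Rightarrow> bool" where
  "R_minimizer a m b p f lo hi x y \<longleftrightarrow>
     is_arg_min (\<lambda>(x, y). R_objective a m b p f lo hi x y)
                (\<lambda>(x, y). R_feasible a m b f lo hi x y) (x, y)"

definition affine_response :: "real ^ 'n::finite \<Rightarrow> real ^ 'n \<Rightarrow> real ^ 'n \<Rightarrow> real ^ 'n" where
  "affine_response a b x = (\<chi> i. (x $ i - b $ i) / a $ i)"

text \<open>Convexity of the reduced problem refers to the problem in \<open>x\<close> alone, with \<open>y\<close> eliminated.\<close>

definition R_convex ::
  "real ^ 'n::finite \<Rightarrow> real ^ 'n \<Rightarrow> real ^ 'n \<Rightarrow> real \<Rightarrow> real \<Rightarrow> real \<Rightarrow> real \<Rightarrow> bool" where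
  "R_convex a m b p f lo hi \<longleftrightarrow>
     convex {x. R_feasible a m b f lo hi x (affine_response a b x)} \<and>
     convex_on UNIV (\<lambda>x. R_objective a m b p f lo hi x (affine_response a b x))"

text \<open>
  All prices \<open>x\<^sub>i \<le> b\<^sub>i\<close> give \<open>y\<^sub>i = 0\<close> and the same cost, so an optimal \<open>x\<close> of (P) may have
  \<open>x\<^sub>i < b\<^sub>i\<close> for some \<open>i \<in> theta_set\<close>, and is then not feasible for the reduced problem, which
  requires \<open>b\<^sub>i \<le> x\<^sub>i\<close>. The following replaces such an \<open>x\<^sub>i\<close> by the equivalent price \<open>b\<^sub>i\<close>.
\<close>

definition raise_price :: "real ^ 'n::finite \<Rightarrow> real ^ 'n \<Rightarrow> real ^ 'n" where
  "raise_price b x = (\<chi> i. max (x $ i) (b $ i))"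

end

theory Submission
  imports Defs
begin

text \<open>
  Once the complementarity system is eliminated, (P) asks for a price vector \<open>x\<close>, each price being
  answered by the demand \<open>response\<close>, the projection of \<open>(x\<^sub>i - b\<^sub>i) / a\<^sub>i\<close> onto \<open>[0, m\<^sub>i]\<close>. This demand
  is flat outside \<open>[b\<^sub>i, a\<^sub>i m\<^sub>i + b\<^sub>i]\<close>, and both flat parts can be removed. A price above
  \<open>a\<^sub>i m\<^sub>i + b\<^sub>i\<close> still buys \<open>m\<^sub>i\<close> units, so any decrease down to \<open>max lo (a\<^sub>i m\<^sub>i + b\<^sub>i)\<close> keeps the
  demand and strictly saves money: this is \<open>lower_price\<close>, and an optimal \<open>x\<close> is a fixed point of it.
  A price below \<open>b\<^sub>i\<close> buys nothing, so increasing it to \<open>b\<^sub>i\<close> is free: this is \<open>raise_price\<close>.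

  The sets \<open>\<alpha>\<close>, \<open>\<beta>\<close>, \<open>\<theta>\<close> partition the indices. On \<open>\<alpha>\<close> the demand is always zero, on \<open>\<beta>\<close> it is
  always \<open>m\<^sub>i\<close>, at the best price \<open>lo\<close>. Hence on points of this shape the two objectives coincide,
  and the two problems dominate each other: every feasible point of (P), lowered and raised, gives
  a feasible point of the reduced problem that costs no more (\<open>feasible_reduce\<close>), and every
  feasible point of the reduced problem extends by the forced values on \<open>\<alpha>\<close> and \<open>\<beta>\<close> to a feasible
  point of (P) of equal cost (\<open>feasible_extend\<close>, \<open>objective_extend\<close>). Minimisers therefore
  correspond. Convexity holds because, after elimination of \<open>y\<close>, the cost of each item is a quadratic
  in \<open>x\<^sub>i\<close> with leading coefficient \<open>1 / a\<^sub>i > 0\<close>, and all constraints are affine.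
\<close>

section \<open>The demand as a function of the price\<close>

definition response :: "real \<Rightarrow> real \<Rightarrow> real \<Rightarrow> real \<Rightarrow> real" where
  "response a m b t = (if t < b then 0 else if t \<le> a * m + b then (t - b) / a else m)"

text \<open>
  The multipliers \<open>\<mu>\<close>, \<open>\<nu>\<close> are determined by \<open>x\<close> and occur neither in the objective nor in another
  constraint, so they can be projected out.
\<close>

definition P_feasible_xy ::
  "real ^ 'n::finite \<Rightarrow> real ^ 'n \<Rightarrow> real ^ 'n \<Rightarrow> real \<Rightarrow> real \<Rightarrow> real \<Rightarrow>
   real ^ 'n \<Rightarrow> real ^ 'n \<Rightarrow> bool" where
  "P_feasible_xy a m b f lo hi x y \<longleftrightarrow>
     (\<forall>i. lo \<le> x $ i \<and> x $ i \<le> hi) \<and> (\<Sum>i\<in>UNIV. y $ i) \<le> f \<and>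
     (\<forall>i. y $ i = response (a $ i) (m $ i) (b $ i) (x $ i))"

lemma P_feasible_imp_xy:
  "P_feasible a m b f lo hi x y \<mu> \<nu> \<Longrightarrow> P_feasible_xy a m b f lo hi x y"
  unfolding P_feasible_def P_feasible_xy_def lower_level_def response_def
  by (auto split: if_splits)

lemma P_feasible_xy_imp_ex:
  fixes a m b :: "real ^ 'n::finite"
  assumes "P_feasible_xy a m b f lo hi x y"
  shows "\<exists>\<mu> \<nu>. P_feasible a m b f lo hi x y \<mu> \<nu>"
proof -
  define \<mu> :: "real ^ 'n" where "\<mu> = (\<chi> i. if x $ i < b $ i then b $ i - x $ i else 0)"
  define \<nu> :: "real ^ 'n" where
    "\<nu> = (\<chi> i. if \<not> x $ i < b $ i \<and> \<not> x $ i \<le> a $ i * m $ i + b $ i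
              then x $ i - a $ i * m $ i - b $ i else 0)"
  have "P_feasible a m b f lo hi x y \<mu> \<nu>"
    using assms
    unfolding P_feasible_def P_feasible_xy_def lower_level_def response_def \<mu>_def \<nu>_def
    by auto
  then show ?thesis by blast
qed

lemma P_optimal_iff:
  "P_optimal a m b p f lo hi x y \<mu> \<nu> \<longleftrightarrow>
     P_feasible a m b f lo hi x y \<mu> \<nu> \<and>
     (\<forall>x' y'. P_feasible_xy a m b f lo hi x' y' \<longrightarrow> P_objective p f x y \<le> P_objective p f x' y')"
  (is "?L \<longleftrightarrow> ?R")
proof
  assume L: ?L
  then have "P_objective p f x y \<le> P_objective p f x' y'"
    if feas: "P_feasible_xy a m b f lo hi x' y'" for x' y'
  proof -
    obtain \<mu>' \<nu>' where "P_feasible a m b f lo hi x' y' \<mu>' \<nu>'"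
      using P_feasible_xy_imp_ex[OF feas] by blast
    then show ?thesis
      using L unfolding P_optimal_def is_arg_min_def by (auto simp: not_less)
  qed
  then show ?R using L unfolding P_optimal_def is_arg_min_def by auto
next
  assume ?R
  then show ?L
    unfolding P_optimal_def is_arg_min_def by (auto simp: not_less dest!: P_feasible_imp_xy)
qed

lemma R_minimizer_iff:
  "R_minimizer a m b p f lo hi x y \<longleftrightarrow>
     R_feasible a m b f lo hi x y \<and>
     (\<forall>x' y'. R_feasible a m b f lo hi x' y' \<longrightarrow>
        R_objective a m b p f lo hi x y \<le> R_objective a m b p f lo hi x' y')"
  unfolding R_minimizer_def is_arg_min_def by (auto simp: not_less)

lemma R_minimizer_cong:
  assumes "\<And>i. i \<in> theta_set a m b lo hi \<Longrightarrow> x $ i = x' $ i"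
  shows "R_minimizer a m b p f lo hi x y \<longleftrightarrow> R_minimizer a m b p f lo hi x' y"
proof -
  have "R_feasible a m b f lo hi x y \<longleftrightarrow> R_feasible a m b f lo hi x' y"
    unfolding R_feasible_def using assms by auto
  moreover have "R_objective a m b p f lo hi x y = R_objective a m b p f lo hi x' y"
    unfolding R_objective_def using assms by auto
  ultimately show ?thesis unfolding R_minimizer_iff by auto
qed

section \<open>Removing prices from the flat parts of the demand\<close>

text \<open>
  The maximum with \<open>lo\<close> keeps the lowered price admissible for items in \<open>\<beta>\<close>, whose demand is
  already saturated at \<open>lo\<close>.
\<close>

definition lower_price ::
  "real ^ 'n::finite \<Rightarrow> real ^ 'n \<Rightarrow> real ^ 'n \<Rightarrow> real \<Rightarrow> real ^ 'n \<Rightarrow> real ^ 'n" where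
  "lower_price a m b lo x = (\<chi> i. min (x $ i) (max lo (a $ i * m $ i + b $ i)))"

locale price_problem =
  fixes a m b :: "real ^ 'n::finite" and p f lo hi :: real
  assumes a_pos: "\<And>i. a $ i > 0" and m_pos: "\<And>i. m $ i > 0" and lo_le_hi: "lo \<le> hi"
begin

abbreviation "\<alpha> \<equiv> alpha_set b hi"
abbreviation "\<beta> \<equiv> beta_set a m b lo"
abbreviation "\<theta> \<equiv> theta_set a m b lo hi"
abbreviation "feasible \<equiv> P_feasible_xy a m b f lo hi"
abbreviation "demand i t \<equiv> response (a $ i) (m $ i) (b $ i) t"

lemma am_pos: "a $ i * m $ i > 0"
  using a_pos m_pos by simp

lemma sum_partition:
  fixes g :: "'n \<Rightarrow> real"
  shows "sum g UNIV = sum g \<alpha> + sum g \<beta> + sum g \<theta>"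
proof -
  have disj: "\<alpha> \<inter> \<beta> = {}" "(\<alpha> \<union> \<beta>) \<inter> \<theta> = {}"
  proof -
    have "\<not> (b $ i > hi \<and> a $ i * m $ i + b $ i < lo)" for i
      using am_pos[of i] lo_le_hi by linarith
    then show "\<alpha> \<inter> \<beta> = {}" unfolding alpha_set_def beta_set_def by blast
    show "(\<alpha> \<union> \<beta>) \<inter> \<theta> = {}" unfolding alpha_set_def beta_set_def theta_set_def by auto
  qed
  have "UNIV = (\<alpha> \<union> \<beta>) \<union> \<theta>"
    unfolding alpha_set_def beta_set_def theta_set_def by auto
  then have "sum g UNIV = sum g ((\<alpha> \<union> \<beta>) \<union> \<theta>)" by simp
  also have "\<dots> = sum g \<alpha> + sum g \<beta> + sum g \<theta>"
    by (simp add: sum.union_disjoint disj)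
  finally show ?thesis .
qed

lemma demand_lower:
  assumes "lo \<le> x $ i"
  shows "demand i (lower_price a m b lo x $ i) = demand i (x $ i)"
proof (cases "x $ i \<le> max lo (a $ i * m $ i + b $ i)")
  case True
  then show ?thesis by (simp add: lower_price_def min_def)
next
  case False
  then have "lower_price a m b lo x $ i = max lo (a $ i * m $ i + b $ i)"
    by (simp add: lower_price_def min_def)
  moreover have "demand i t = m $ i" if "t \<ge> a $ i * m $ i + b $ i" for t
    using that am_pos[of i] a_pos[of i] unfolding response_def by (auto simp: field_simps)
  ultimately show ?thesis using False by auto
qed

lemma feasible_lower:
  assumes "feasible x y"
  shows "feasible (lower_price a m b lo x) y"
  using assms demand_lower unfolding P_feasible_xy_def
  by (auto simp: lower_price_def min_le_iff_disj)

text \<open>Where the price changes, the demand is \<open>m\<^sub>i > 0\<close>, so the payment drops strictly.\<close>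

lemma payment_lower:
  assumes "feasible x y" and "x $ i \<noteq> lower_price a m b lo x $ i"
  shows "lower_price a m b lo x $ i * y $ i < x $ i * y $ i"
proof -
  have gt: "x $ i > max lo (a $ i * m $ i + b $ i)"
    using assms(2) by (auto simp: lower_price_def min_def split: if_splits)
  then have "y $ i = m $ i"
    using assms(1) am_pos[of i] unfolding P_feasible_xy_def response_def by auto
  then show ?thesis using gt m_pos[of i] assms(2) by (auto simp: lower_price_def min_def)
qed

lemma payment_lower_le:
  assumes "feasible x y"
  shows "lower_price a m b lo x $ i * y $ i \<le> x $ i * y $ i"
  using payment_lower[OF assms, of i] by fastforce

lemma objective_lower_le:
  assumes "feasible x y"
  shows "P_objective p f (lower_price a m b lo x) y \<le> P_objective p f x y"
  unfolding P_objective_def using payment_lower_le[OF assms] by (simp add: sum_mono)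

lemma optimal_lower_price_eq:
  assumes opt: "P_optimal a m b p f lo hi x y \<mu> \<nu>"
  shows "lower_price a m b lo x = x"
proof (rule ccontr)
  assume "lower_price a m b lo x \<noteq> x"
  then obtain j where j: "x $ j \<noteq> lower_price a m b lo x $ j" by (metis vec_eq_iff)
  have feas: "feasible x y"
    using opt P_feasible_imp_xy unfolding P_optimal_iff by blast
  have "(\<Sum>i\<in>UNIV. lower_price a m b lo x $ i * y $ i) < (\<Sum>i\<in>UNIV. x $ i * y $ i)"
    by (rule sum_strict_mono_ex1) (use payment_lower_le[OF feas] payment_lower[OF feas j] in auto)
  then have "P_objective p f (lower_price a m b lo x) y < P_objective p f x y"
    unfolding P_objective_def by simp
  then show False using opt feasible_lower[OF feas] unfolding P_optimal_iff by fastforce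
qed

section \<open>Passing between the two problems\<close>

lemma demand_alpha: "feasible x y \<Longrightarrow> i \<in> \<alpha> \<Longrightarrow> y $ i = 0"
  unfolding P_feasible_xy_def response_def alpha_set_def by (auto dest: spec[of _ i])

lemma demand_beta: "feasible x y \<Longrightarrow> i \<in> \<beta> \<Longrightarrow> y $ i = m $ i"
  using am_pos[of i] unfolding P_feasible_xy_def response_def beta_set_def
  by (auto dest: spec[of _ i])

lemma lowered_beta: "feasible x y \<Longrightarrow> i \<in> \<beta> \<Longrightarrow> lower_price a m b lo x $ i = lo"
  unfolding P_feasible_xy_def beta_set_def lower_price_def by auto

lemma objective_extend:
  assumes "\<And>i. i \<in> \<alpha> \<Longrightarrow> y $ i = 0" and "\<And>i. i \<in> \<beta> \<Longrightarrow> x $ i = lo \<and> y $ i = m $ i"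
  shows "P_objective p f x y = R_objective a m b p f lo hi x y"
proof -
  have "(\<Sum>i\<in>UNIV. x $ i * y $ i) = (\<Sum>i\<in>\<beta>. lo * m $ i) + (\<Sum>i\<in>\<theta>. x $ i * y $ i)"
    unfolding sum_partition using assms by simp
  moreover have "(\<Sum>i\<in>UNIV. y $ i) = (\<Sum>i\<in>\<beta>. m $ i) + (\<Sum>i\<in>\<theta>. y $ i)"
    unfolding sum_partition using assms by simp
  ultimately show ?thesis
    unfolding P_objective_def R_objective_def by (simp add: algebra_simps)
qed

lemma feasible_extend:
  assumes R: "R_feasible a m b f lo hi x y"
    and alpha: "\<And>i. i \<in> \<alpha> \<Longrightarrow> x $ i \<in> {lo..hi} \<and> y $ i = 0"
    and beta: "\<And>i. i \<in> \<beta> \<Longrightarrow> x $ i = lo \<and> y $ i = m $ i"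
  shows "feasible x y"
proof -
  have "lo \<le> x $ i \<and> x $ i \<le> hi \<and> y $ i = demand i (x $ i)" for i
  proof -
    consider "i \<in> \<alpha>" | "i \<in> \<beta>" | "i \<in> \<theta>"
      unfolding alpha_set_def beta_set_def theta_set_def by fastforce
    then show ?thesis
    proof cases
      case 1
      then show ?thesis using alpha[of i] by (auto simp: response_def alpha_set_def)
    next
      case 2
      then show ?thesis
        using beta[of i] lo_le_hi am_pos[of i] by (auto simp: response_def beta_set_def)
    next
      case 3
      then show ?thesis using R unfolding R_feasible_def response_def by auto
    qed
  qed
  moreover have "(\<Sum>i\<in>UNIV. y $ i) = (\<Sum>i\<in>\<beta>. m $ i) + (\<Sum>i\<in>\<theta>. y $ i)"
    unfolding sum_partition using alpha beta by simp
  then have "(\<Sum>i\<in>UNIV. y $ i) \<le> f" using R unfolding R_feasible_def by linarith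
  ultimately show ?thesis unfolding P_feasible_xy_def by blast
qed

text \<open>
  After lowering, only prices below \<open>b\<^sub>i\<close> violate the constraints of the reduced problem. Raising
  them is harmless because \<open>b\<^sub>i \<le> hi\<close> on \<open>\<theta>\<close> and the demand is zero at \<open>b\<^sub>i\<close> and below.
\<close>

lemma feasible_reduce:
  assumes feas: "feasible x y"
  shows "R_feasible a m b f lo hi (raise_price b (lower_price a m b lo x)) y"
proof -
  let ?z = "lower_price a m b lo x"
  let ?u = "raise_price b ?z"
  have z: "feasible ?z y" using feasible_lower[OF feas] .
  have "lo \<le> ?u $ i \<and> ?u $ i \<le> hi \<and> y $ i = (?u $ i - b $ i) / a $ i \<and>
        b $ i \<le> ?u $ i \<and> ?u $ i \<le> a $ i * m $ i + b $ i" if i: "i \<in> \<theta>" for i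
  proof -
    have z_le: "?z $ i \<le> a $ i * m $ i + b $ i"
      using i unfolding theta_set_def lower_price_def by (auto simp: min_le_iff_disj)
    have z_i: "lo \<le> ?z $ i" "?z $ i \<le> hi" "y $ i = demand i (?z $ i)"
      using z unfolding P_feasible_xy_def by auto
    then have "y $ i = (?u $ i - b $ i) / a $ i"
      using z_le by (auto simp: response_def raise_price_def max_def)
    then show ?thesis
      using z_le z_i i am_pos[of i] by (auto simp: theta_set_def raise_price_def max_def)
  qed
  moreover have "(\<Sum>i\<in>UNIV. y $ i) = (\<Sum>i\<in>\<beta>. m $ i) + (\<Sum>i\<in>\<theta>. y $ i)"
    unfolding sum_partition using demand_alpha[OF feas] demand_beta[OF feas] by simp
  then have "(\<Sum>i\<in>\<theta>. y $ i) \<le> f - (\<Sum>i\<in>\<beta>. m $ i)"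
    using feas unfolding P_feasible_xy_def by linarith
  ultimately show ?thesis unfolding R_feasible_def by blast
qed

lemma R_objective_raise:
  assumes "feasible x y"
  shows "R_objective a m b p f lo hi (raise_price b x) y = R_objective a m b p f lo hi x y"
proof -
  have "raise_price b x $ i * y $ i = x $ i * y $ i" for i
    using assms unfolding P_feasible_xy_def response_def raise_price_def by (auto simp: max_def)
  then show ?thesis unfolding R_objective_def by (simp only:)
qed

lemma objective_reduce:
  assumes feas: "feasible x y"
  shows "R_objective a m b p f lo hi (raise_price b (lower_price a m b lo x)) y =
         P_objective p f (lower_price a m b lo x) y"
  unfolding R_objective_raise[OF feasible_lower[OF feas]]
  using objective_extend[of y "lower_price a m b lo x"]
    demand_alpha[OF feas] demand_beta[OF feas] lowered_beta[OF feas] by simp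

section \<open>Correspondence of minimisers\<close>

lemma optimal_imp_R_minimizer:
  assumes opt: "P_optimal a m b p f lo hi x y \<mu> \<nu>"
  shows "R_minimizer a m b p f lo hi (raise_price b x) y"
proof -
  have feas: "feasible x y"
    using opt P_feasible_imp_xy unfolding P_optimal_iff by blast
  note low = optimal_lower_price_eq[OF opt]
  have "R_objective a m b p f lo hi (raise_price b x) y \<le> R_objective a m b p f lo hi u v"
    if uv: "R_feasible a m b f lo hi u v" for u v
  proof -
    \<comment> \<open>The competitor \<open>u\<close>, \<open>v\<close> becomes one for (P) by the forced demand off \<open>\<theta>\<close>; the price \<open>lo\<close> is
      optimal on \<open>\<beta>\<close> and as good as any other on \<open>\<alpha>\<close>.\<close>
    define X :: "real ^ 'n" where "X = (\<chi> i. if i \<in> \<theta> then u $ i else lo)"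
    define Y :: "real ^ 'n" where
      "Y = (\<chi> i. if i \<in> \<theta> then v $ i else if i \<in> \<beta> then m $ i else 0)"
    have alpha: "X $ i \<in> {lo..hi} \<and> Y $ i = 0" if "i \<in> \<alpha>" for i
      using that lo_le_hi am_pos[of i]
      by (auto simp: X_def Y_def alpha_set_def beta_set_def theta_set_def)
    have beta: "X $ i = lo \<and> Y $ i = m $ i" if "i \<in> \<beta>" for i
      using that by (auto simp: X_def Y_def beta_set_def theta_set_def)
    have XY: "R_feasible a m b f lo hi X Y"
    proof -
      have "R_feasible a m b f lo hi X Y \<longleftrightarrow> R_feasible a m b f lo hi u v"
        unfolding R_feasible_def by (simp add: X_def Y_def)
      then show ?thesis using uv ..
    qed
    have "R_objective a m b p f lo hi (raise_price b x) y = P_objective p f x y"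
      using objective_reduce[OF feas] low by simp
    also have "\<dots> \<le> P_objective p f X Y"
      using opt feasible_extend[OF XY alpha beta] unfolding P_optimal_iff by blast
    also have "\<dots> = R_objective a m b p f lo hi X Y"
      using objective_extend[of Y X] alpha beta by blast
    also have "\<dots> = R_objective a m b p f lo hi u v"
      unfolding R_objective_def by (simp add: X_def Y_def)
    finally show ?thesis .
  qed
  then show ?thesis
    using feasible_reduce[OF feas] unfolding R_minimizer_iff low by blast
qed

lemma R_minimizer_imp_optimal:
  assumes min: "R_minimizer a m b p f lo hi x y"
    and alpha: "\<And>i. i \<in> \<alpha> \<Longrightarrow> x $ i \<in> {lo..hi} \<and> y $ i = 0"
    and beta: "\<And>i. i \<in> \<beta> \<Longrightarrow> x $ i = lo \<and> y $ i = m $ i"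
  shows "\<exists>\<mu> \<nu>. P_optimal a m b p f lo hi x y \<mu> \<nu>"
proof -
  have feas: "feasible x y"
    using feasible_extend[OF _ alpha beta] min unfolding R_minimizer_iff by blast
  have "P_objective p f x y \<le> P_objective p f x' y'" if feas': "feasible x' y'" for x' y'
  proof -
    have "P_objective p f x y = R_objective a m b p f lo hi x y"
      using objective_extend[of y x] alpha beta by blast
    also have "\<dots> \<le> R_objective a m b p f lo hi (raise_price b (lower_price a m b lo x')) y'"
      using min feasible_reduce[OF feas'] unfolding R_minimizer_iff by blast
    also have "\<dots> \<le> P_objective p f x' y'"
      using objective_reduce[OF feas'] objective_lower_le[OF feas'] by simp
    finally show ?thesis .
  qed
  then show ?thesis
    using P_feasible_xy_imp_ex[OF feas] unfolding P_optimal_iff by blast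
qed

section \<open>Convexity of the reduced problem\<close>

lemma convex_R_feasible:
  "convex {x. R_feasible a m b f lo hi x (affine_response a b x)}"
proof -
  have "{x. R_feasible a m b f lo hi x (affine_response a b x)} =
      (\<Inter>i\<in>\<theta>. {x. lo \<le> x $ i} \<inter> {x. x $ i \<le> hi} \<inter>
              {x. b $ i \<le> x $ i} \<inter> {x. x $ i \<le> a $ i * m $ i + b $ i}) \<inter>
      {x. (\<Sum>i\<in>\<theta>. (x $ i - b $ i) / a $ i) \<le> f - (\<Sum>i\<in>\<beta>. m $ i)}"
    unfolding R_feasible_def affine_response_def by auto
  moreover have "convex {x :: real ^ 'n. c \<le> x $ i}" "convex {x :: real ^ 'n. x $ i \<le> c}" for c i
    using convex_halfspace_ge[of c "axis i (1 :: real)"] convex_halfspace_le[of "axis i (1 :: real)" c]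
    by (simp_all add: inner_axis')
  moreover have "convex {x :: real ^ 'n. (\<Sum>i\<in>\<theta>. (x $ i - b $ i) / a $ i) \<le> c}" for c
  proof -
    \<comment> \<open>The capacity constraint is a half-space: its normal has the entries \<open>1 / a\<^sub>i\<close> on \<open>\<theta>\<close>.\<close>
    define w :: "real ^ 'n" where "w = (\<chi> i. if i \<in> \<theta> then 1 / a $ i else 0)"
    have "w \<bullet> x = (\<Sum>i\<in>\<theta>. x $ i / a $ i)" for x
      unfolding w_def inner_vec_def
      by (simp add: if_distrib[of "\<lambda>t. t * _"] sum.If_cases cong: if_cong)
    then have "{x. (\<Sum>i\<in>\<theta>. (x $ i - b $ i) / a $ i) \<le> c} =
        {x. w \<bullet> x \<le> c + (\<Sum>i\<in>\<theta>. b $ i / a $ i)}"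
      by (auto simp: diff_divide_distrib sum_subtractf)
    then show ?thesis by (simp add: convex_halfspace_le)
  qed
  ultimately show ?thesis by (auto intro!: convex_Int convex_INT)
qed

lemma convex_on_affine_payment:
  "convex_on UNIV (\<lambda>x :: real ^ 'n. (x $ i - p) * ((x $ i - b $ i) / a $ i))"
proof (rule convex_onI)
  fix t :: real and x y :: "real ^ 'n"
  assume t: "0 < t" "t < 1"
  define u v where "u = x $ i" and "v = y $ i"
  \<comment> \<open>The convexity defect of a quadratic is its leading coefficient times \<open>t (1 - t) (u - v)\<^sup>2\<close>.\<close>
  have "(1 - t) * ((u - p) * (u - b $ i)) + t * ((v - p) * (v - b $ i))
      - ((1 - t) * u + t * v - p) * ((1 - t) * u + t * v - b $ i) = t * (1 - t) * (u - v)\<^sup>2"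
    by (simp add: algebra_simps power2_eq_square)
  then have "((1 - t) * u + t * v - p) * ((1 - t) * u + t * v - b $ i)
      \<le> (1 - t) * ((u - p) * (u - b $ i)) + t * ((v - p) * (v - b $ i))"
    using t by (smt (verit) mult_nonneg_nonneg zero_le_power2)
  then have "((1 - t) * u + t * v - p) * ((1 - t) * u + t * v - b $ i) / a $ i
      \<le> ((1 - t) * ((u - p) * (u - b $ i)) + t * ((v - p) * (v - b $ i))) / a $ i"
    using a_pos[of i] by (simp add: divide_right_mono)
  then show "(((1 - t) *\<^sub>R x + t *\<^sub>R y) $ i - p) * ((((1 - t) *\<^sub>R x + t *\<^sub>R y) $ i - b $ i) / a $ i)
      \<le> (1 - t) * ((x $ i - p) * ((x $ i - b $ i) / a $ i))
        + t * ((y $ i - p) * ((y $ i - b $ i) / a $ i))"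
    by (simp add: u_def v_def add_divide_distrib)
qed simp

lemma convex_on_R_objective:
  "convex_on UNIV (\<lambda>x. R_objective a m b p f lo hi x (affine_response a b x))"
proof -
  \<comment> \<open>Each unit bought at price \<open>x\<^sub>i\<close> replaces one bought at \<open>p\<close>, so only \<open>x\<^sub>i - p\<close> matters.\<close>
  have "R_objective a m b p f lo hi x (affine_response a b x) =
      (\<Sum>i\<in>\<theta>. (x $ i - p) * ((x $ i - b $ i) / a $ i)) +
      ((\<Sum>i\<in>\<beta>. lo * m $ i) + p * (f - (\<Sum>i\<in>\<beta>. m $ i)))" for x
  proof -
    have "(\<Sum>i\<in>\<theta>. (x $ i - p) * ((x $ i - b $ i) / a $ i)) =
        (\<Sum>i\<in>\<theta>. x $ i * ((x $ i - b $ i) / a $ i)) - p * (\<Sum>i\<in>\<theta>. (x $ i - b $ i) / a $ i)"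
      unfolding left_diff_distrib sum_subtractf sum_distrib_left ..
    then show ?thesis
      unfolding R_objective_def affine_response_def by (simp add: right_diff_distrib)
  qed
  moreover have "convex_on UNIV (\<lambda>x :: real ^ 'n.
      \<Sum>i\<in>S. (x $ i - p) * ((x $ i - b $ i) / a $ i))" if "finite S" for S
    using that
  proof induction
    case empty
    then show ?case by (simp add: convex_on_const)
  next
    case (insert i S)
    then show ?case using convex_on_add[OF convex_on_affine_payment[of i]] by simp
  qed
  ultimately show ?thesis by (simp add: convex_on_add convex_on_const)
qed

end

section \<open>The reduction theorem\<close>

theorem theorem7:
  fixes a m b :: "real ^ 'n" and p f lo hi :: real
  assumes "\<And>i. a $ i > 0" and "\<And>i. m $ i > 0"
    and "p > 0" and "f > 0"
    and "0 \<le> lo" and "lo \<le> hi"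
  shows
    "R_convex a m b p f lo hi \<and>
     (\<forall>x y \<mu> \<nu>. P_optimal a m b p f lo hi x y \<mu> \<nu> \<longrightarrow>
        (\<forall>i\<in>alpha_set b hi. x $ i \<in> {lo..hi} \<and> y $ i = 0) \<and>
        (\<forall>i\<in>beta_set a m b lo. x $ i = lo \<and> y $ i = m $ i) \<and>
        ((\<forall>i\<in>theta_set a m b lo hi. b $ i \<le> x $ i) \<longrightarrow> R_minimizer a m b p f lo hi x y) \<and>
        R_minimizer a m b p f lo hi (raise_price b x) y) \<and>
     (\<forall>x y.
        (\<forall>i\<in>alpha_set b hi. x $ i \<in> {lo..hi} \<and> y $ i = 0) \<and>
        (\<forall>i\<in>beta_set a m b lo. x $ i = lo \<and> y $ i = m $ i) \<and>
        R_minimizer a m b p f lo hi x y \<longrightarrow>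
        (\<exists>\<mu> \<nu>. P_optimal a m b p f lo hi x y \<mu> \<nu>))"
proof -
  interpret price_problem a m b p f lo hi
    by unfold_locales (use assms in auto)
  have "R_convex a m b p f lo hi"
    unfolding R_convex_def using convex_R_feasible convex_on_R_objective by blast
  moreover have
    "(\<forall>i\<in>\<alpha>. x $ i \<in> {lo..hi} \<and> y $ i = 0) \<and> (\<forall>i\<in>\<beta>. x $ i = lo \<and> y $ i = m $ i) \<and>
     ((\<forall>i\<in>\<theta>. b $ i \<le> x $ i) \<longrightarrow> R_minimizer a m b p f lo hi x y) \<and>
     R_minimizer a m b p f lo hi (raise_price b x) y"
    if opt: "P_optimal a m b p f lo hi x y \<mu> \<nu>" for x y \<mu> \<nu>
  proof -
    have feas: "feasible x y"
      using opt P_feasible_imp_xy unfolding P_optimal_iff by blast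
    have "x $ i \<in> {lo..hi}" for i using feas unfolding P_feasible_xy_def by simp
    moreover have "x $ i = lo" if "i \<in> \<beta>" for i
      using lowered_beta[OF feas that] optimal_lower_price_eq[OF opt] by simp
    moreover have "R_minimizer a m b p f lo hi x y" if "\<forall>i\<in>\<theta>. b $ i \<le> x $ i"
    proof -
      have "x $ i = raise_price b x $ i" if "i \<in> \<theta>" for i
        using that \<open>\<forall>i\<in>\<theta>. b $ i \<le> x $ i\<close> by (simp add: raise_price_def)
      then show ?thesis using optimal_imp_R_minimizer[OF opt] R_minimizer_cong by blast
    qed
    ultimately show ?thesis
      using demand_alpha[OF feas] demand_beta[OF feas] optimal_imp_R_minimizer[OF opt] by blast
  qed
  moreover have "\<exists>\<mu> \<nu>. P_optimal a m b p f lo hi x y \<mu> \<nu>"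
    if "(\<forall>i\<in>\<alpha>. x $ i \<in> {lo..hi} \<and> y $ i = 0) \<and> (\<forall>i\<in>\<beta>. x $ i = lo \<and> y $ i = m $ i) \<and>
        R_minimizer a m b p f lo hi x y" for x y
    using R_minimizer_imp_optimal[of x y] that by blast
  ultimately show ?thesis by blast
qed

end
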